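(* Let $\nu\ge 2$ be an integer. For each $1\le i<\nu$ let $p_i,k_i,c_i$ denote integers in $\{0,1,\dots,i\}$ (the components, with index $\nu-i-1$, of the Lehmer codewords of the plaintext $p$, the key $k$ and the ciphertext $c$, respectively), and write $p=(p_1,\dots,p_{\nu-1})$, $k=(k_1,\dots,k_{\nu-1})$, $c=(c_1,\dots,c_{\nu-1})$. For each $2\le i\le \nu-1$ let $$R_i:K_{i-1}\times \mathbb{N}_{i}\times\mathbb{N}_i\to K_i$$ be an arbitrary surjection that depends on each of its arguments. Given $p$ and $k$, let $\pi_1$ be the unique element of $K_1$ (the transposition, $1\ 0$ in one-line notation), let $$\pi_i=R_i(\pi_{i-1},k_{i-1},p_{i-1})\qquad (i=2,\dots,\nu-1),$$ and let $$c_i=\pi_i^{k_i}[p_i]\qquad (i=1,\dots,\nu-1).$$ Then the relation between $p$, $c$ and $k$ so defined is a non-degenerate trijection.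
   Context: $\mathbb{N}_i=\{0,1,\dots,i-1\}$. $S_r$ is the group of permutations of $\{0,\dots,r-1\}$; for $\pi\in S_r$, $\pi[j]$ is the image of $j$ (the $j$-th entry of the one-line notation, indexed from $0$), and $\pi^k$ is the $k$-th power of $\pi$. A permutation in $S_r$ is called cyclic if it consists of a single cycle of length $r$; $K_i$ is the set of all cyclic permutations in $S_{i+1}$. "$R_i$ depends on each of its arguments" means: for each of the three arguments whose range has more than one element, there are values of the other two arguments for which $R_i$ is not constant in that argument. A ternary relation between $p$, $c$ and $k$ (each ranging over a fixed finite set; here each ranges over $\prod_{i=1}^{\nu-1}\{0,\dots,i\}$) is a trijection if, whenever any one of the three is fixed, it is a bijection between the other two: for each $k$ the relation is a bijection between the values of $p$ and of $c$; for each $p$ it is a bijection between the values of $k$ and of $c$; for each $c$ it is a bijection between the values of $p$ and of $k$. The trijection is called degenerate if there is more than one component (i.e. $\nu\ge 3$) and it acts position-wise, i.e. for every $i$ the value $c_i$ is a function of $p_i$ and $k_i$ alone. It is non-degenerate otherwise; in particular a single-component trijection is non-degenerate. *)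

theory Defs
  imports "HOL-Combinatorics.Combinatorics" "HOL-Library.FuncSet"
begin

definition K :: "nat \<Rightarrow> (nat \<Rightarrow> nat) set" where
  "K i = {\<pi>. \<pi> permutes {0..i} \<and> cyclic_on \<pi> {0..i}}"

definition depends_on_each_argument ::
    "'a set \<Rightarrow> 'b set \<Rightarrow> 'c set \<Rightarrow> ('a \<times> 'b \<times> 'c \<Rightarrow> 'd) \<Rightarrow> bool" where
  "depends_on_each_argument A B C f \<longleftrightarrow>
     ((\<exists>a\<in>A. \<exists>a'\<in>A. a \<noteq> a') \<longrightarrow>
        (\<exists>b\<in>B. \<exists>c\<in>C. \<exists>a\<in>A. \<exists>a'\<in>A. f (a, b, c) \<noteq> f (a', b, c))) \<and>
     ((\<exists>b\<in>B. \<exists>b'\<in>B. b \<noteq> b') \<longrightarrow>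
        (\<exists>a\<in>A. \<exists>c\<in>C. \<exists>b\<in>B. \<exists>b'\<in>B. f (a, b, c) \<noteq> f (a, b', c))) \<and>
     ((\<exists>c\<in>C. \<exists>c'\<in>C. c \<noteq> c') \<longrightarrow>
        (\<exists>a\<in>A. \<exists>b\<in>B. \<exists>c\<in>C. \<exists>c'\<in>C. f (a, b, c) \<noteq> f (a, b, c')))"

definition is_bijection_between :: "'a set \<Rightarrow> 'b set \<Rightarrow> ('a \<Rightarrow> 'b \<Rightarrow> bool) \<Rightarrow> bool" where
  "is_bijection_between A B r \<longleftrightarrow>
     (\<exists>f. bij_betw f A B \<and> (\<forall>a\<in>A. \<forall>b\<in>B. r a b \<longleftrightarrow> b = f a))"

definition trijection ::
    "'p set \<Rightarrow> 'c set \<Rightarrow> 'k set \<Rightarrow> ('p \<Rightarrow> 'c \<Rightarrow> 'k \<Rightarrow> bool) \<Rightarrow> bool" where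
  "trijection P C Q T \<longleftrightarrow>
     (\<forall>k\<in>Q. is_bijection_between P C (\<lambda>p c. T p c k)) \<and>
     (\<forall>p\<in>P. is_bijection_between Q C (\<lambda>k c. T p c k)) \<and>
     (\<forall>c\<in>C. is_bijection_between P Q (\<lambda>p k. T p c k))"

definition words :: "nat \<Rightarrow> (nat \<Rightarrow> nat) set" where
  "words \<nu> = (\<Pi>\<^sub>E i\<in>{1..<\<nu>}. {0..i})"

definition positionwise ::
    "nat \<Rightarrow> ((nat \<Rightarrow> nat) \<Rightarrow> (nat \<Rightarrow> nat) \<Rightarrow> (nat \<Rightarrow> nat) \<Rightarrow> bool) \<Rightarrow> bool" where
  "positionwise \<nu> T \<longleftrightarrow>
     (\<forall>i\<in>{1..<\<nu>}. \<exists>f. \<forall>p\<in>words \<nu>. \<forall>c\<in>words \<nu>. \<forall>k\<in>words \<nu>.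
        T p c k \<longrightarrow> c i = f (p i) (k i))"

definition degenerate ::
    "nat \<Rightarrow> ((nat \<Rightarrow> nat) \<Rightarrow> (nat \<Rightarrow> nat) \<Rightarrow> (nat \<Rightarrow> nat) \<Rightarrow> bool) \<Rightarrow> bool" where
  "degenerate \<nu> T \<longleftrightarrow> 3 \<le> \<nu> \<and> positionwise \<nu> T"

(* The sequence of permutations starts at index 1; the value at index 0 is never used. *)
fun perm_seq ::
    "(nat \<Rightarrow> (nat \<Rightarrow> nat) \<times> nat \<times> nat \<Rightarrow> (nat \<Rightarrow> nat)) \<Rightarrow>
     (nat \<Rightarrow> nat) \<Rightarrow> (nat \<Rightarrow> nat) \<Rightarrow> nat \<Rightarrow> (nat \<Rightarrow> nat)" where
  "perm_seq R p k 0 = id"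
| "perm_seq R p k (Suc 0) = transpose 0 1"
| "perm_seq R p k (Suc (Suc i)) =
     R (Suc (Suc i)) (perm_seq R p k (Suc i), k (Suc i), p (Suc i))"

lemma K_1: "K 1 = {transpose 0 1}"
proof -
  have S: "{0..1::nat} = {0, 1}" by auto
  have A: "\<pi> = transpose 0 1"
    if "\<pi> permutes {0, 1}" "cyclic_on \<pi> {0, 1}" for \<pi> :: "nat \<Rightarrow> nat"
  proof -
    have "\<pi> \<noteq> id"
    proof
      assume "\<pi> = id"
      then have "orbit \<pi> x = {x}" for x by (simp add: orbit_eq_singleton_iff)
      with that(2) show False by (auto simp: cyclic_on_def)
    qed
    with that(1) show ?thesis by (simp add: permutes_doubleton_iff)
  qed
  have B: "transpose (0::nat) 1 permutes {0, 1}"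
    by (simp add: permutes_swap_id)
  have "orbit (transpose (0::nat) 1) 0 = {0, 1}"
  proof
    show "orbit (transpose (0::nat) 1) 0 \<subseteq> {0, 1}"
      by (rule permutes_orbit_subset[OF B]) simp
    have "1 \<in> orbit (transpose (0::nat) 1) 0"
      using orbit.base[of "transpose (0::nat) 1" 0] by simp
    moreover from orbit.step[OF this] have "0 \<in> orbit (transpose (0::nat) 1) 0"
      by simp
    ultimately show "{0, 1} \<subseteq> orbit (transpose (0::nat) 1) 0" by simp
  qed
  then have "cyclic_on (transpose (0::nat) 1) {0, 1}"
    unfolding cyclic_on_def by blast
  with A B show ?thesis unfolding K_def S by blast
qed

definition cipher_relation ::
    "nat \<Rightarrow> (nat \<Rightarrow> (nat \<Rightarrow> nat) \<times> nat \<times> nat \<Rightarrow> (nat \<Rightarrow> nat)) \<Rightarrow>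
     (nat \<Rightarrow> nat) \<Rightarrow> (nat \<Rightarrow> nat) \<Rightarrow> (nat \<Rightarrow> nat) \<Rightarrow> bool" where
  "cipher_relation \<nu> R p c k \<longleftrightarrow>
     (\<forall>i\<in>{1..<\<nu>}. c i = (perm_seq R p k i ^^ k i) (p i))"

end

theory Submission
  imports Defs
begin

text \<open>
  The permutation \<open>\<pi>\<^sub>i\<close> depends only on the entries of the plaintext and of the key at
  positions below \<open>i\<close>. So, with one of the words fixed, the missing one is determined entry by entry: each
  entry satisfies an equation with exactly one solution, because a power of a permutation is
  injective and because the powers \<open>\<pi>\<^sup>0, \<dots>, \<pi>\<^sup>i\<close> of a cycle of length \<open>i + 1\<close> take each point to
  every point exactly once. For non-degeneracy, \<open>R\<^sub>2\<close> takes two different values \<open>\<sigma>\<close>, \<open>\<tau>\<close>; at a point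
  \<open>x\<close> with \<open>\<sigma> x \<noteq> \<tau> x\<close> the choice \<open>p\<^sub>2 = x\<close>, \<open>k\<^sub>2 = 1\<close> does not determine \<open>c\<^sub>2\<close>.
\<close>

text \<open>Forward substitution: the condition at \<open>i\<close> sees only the entries below
  \<open>i\<close>, so the unique solution on \<open>{1..<n}\<close> is extended by the unique
  admissible value at \<open>n\<close>.\<close>

lemma Ex1_PiE_triangular:
  assumes "\<And>i w. i \<in> {1..<n} \<Longrightarrow> w \<in> PiE {1..<i} A \<Longrightarrow> \<exists>!v. v \<in> A i \<and> P i w v"
  shows "\<exists>!w. w \<in> PiE {1..<n::nat} A \<and> (\<forall>i\<in>{1..<n}. P i (restrict w {1..<i}) (w i))"
  using assms
proof (induction n)
  case 0
  show ?case by simp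
next
  case (Suc n)
  show ?case
  proof (cases "n = 0")
    case True
    then show ?thesis by simp
  next
    case False
    then have I: "{1..<Suc n} = insert n {1..<n}" by auto
    have Ex: "\<exists>!w. w \<in> PiE {1..<n} A \<and> (\<forall>i\<in>{1..<n}. P i (restrict w {1..<i}) (w i))"
      by (intro Suc.IH Suc.prems) auto
    then obtain w where w: "w \<in> PiE {1..<n} A"
        "\<forall>i\<in>{1..<n}. P i (restrict w {1..<i}) (w i)"
      by blast
    have "\<exists>!v. v \<in> A n \<and> P n w v"
      using Suc.prems[of n w] w(1) False by simp
    then obtain v where v: "v \<in> A n" "P n w v" "\<And>v'. v' \<in> A n \<Longrightarrow> P n w v' \<Longrightarrow> v' = v"
      by blast
    show ?thesis
    proof (rule ex1I[of _ "w(n := v)"])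
      have "restrict (w(n := v)) {1..<i} = restrict w {1..<i}" if "i \<le> n" for i
        using that by (auto simp: restrict_def)
      moreover have "restrict w {1..<n} = w"
        using w(1) by (rule PiE_restrict)
      ultimately show "w(n := v) \<in> PiE {1..<Suc n} A \<and>
          (\<forall>i\<in>{1..<Suc n}. P i (restrict (w(n := v)) {1..<i}) ((w(n := v)) i))"
        using w v(1,2) unfolding I by (auto intro!: PiE_fun_upd)
    next
      fix u
      assume u: "u \<in> PiE {1..<Suc n} A \<and> (\<forall>i\<in>{1..<Suc n}. P i (restrict u {1..<i}) (u i))"
      \<comment> \<open>Cutting off the last entry of any solution \<open>u\<close> leaves a
        solution of the shorter system, which must be \<open>w\<close>.\<close>
      have "restrict u {1..<n} \<in> PiE {1..<n} A"
        using u by (auto simp: PiE_iff)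
      moreover have "P i (restrict (restrict u {1..<n}) {1..<i}) (restrict u {1..<n} i)"
        if "i \<in> {1..<n}" for i
      proof -
        have "{1..<n} \<inter> {1..<i} = {1..<i}" using that by auto
        then show ?thesis using u that by (simp add: Int_absorb1)
      qed
      ultimately have uw: "restrict u {1..<n} = w"
        using Ex w by blast
      have "u n \<in> A n" "P n (restrict u {1..<n}) (u n)"
        using u \<open>n \<noteq> 0\<close> by auto
      then have "u n = v"
        using v(3) uw by metis
      show "u = w(n := v)"
      proof
        fix j
        show "u j = (w(n := v)) j"
        proof (cases "j \<in> {1..<Suc n}")
          case True
          then show ?thesis using uw \<open>u n = v\<close> by (cases "j = n") auto
        next
          case False
          moreover have "w j = undefined" if "j \<notin> {1..<n}"
            using w(1) that by (rule PiE_arb)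
          ultimately show ?thesis
            using u \<open>n \<noteq> 0\<close> by (auto simp: PiE_iff extensional_def)
        qed
      qed
    qed
  qed
qed

text \<open>Reduces the three clauses of \<open>trijection\<close> to three facts of unique
  existence, one for each missing word; each of them serves in two clauses.\<close>

lemma is_bijection_betweenI:
  assumes "\<And>a. a \<in> A \<Longrightarrow> \<exists>!b. b \<in> B \<and> r a b"
    and "\<And>b. b \<in> B \<Longrightarrow> \<exists>!a. a \<in> A \<and> r a b"
  shows "is_bijection_between A B r"
proof -
  define f where "f a = (THE b. b \<in> B \<and> r a b)" for a
  have f: "f a \<in> B" "r a (f a)" if "a \<in> A" for a
    using theI'[OF assms(1)[OF that]] by (auto simp: f_def)
  have r: "r a b \<longleftrightarrow> b = f a" if "a \<in> A" "b \<in> B" for a b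
    using assms(1)[OF that(1)] f[OF that(1)] that(2) by blast
  have "bij_betw f A B"
    unfolding bij_betw_def inj_on_def
    using f r assms(2) by (safe; blast)
  then show ?thesis
    unfolding is_bijection_between_def using r by blast
qed

text \<open>The orbit of \<open>x\<close> is all of \<open>S\<close>. Its iterates are distinct
  until the first return to \<open>x\<close>, so the return time \<open>funpow_dist1 f x x\<close>
  equals \<open>card S\<close>.\<close>

lemma cyclic_on_ex1_funpow:
  assumes "cyclic_on f S" "finite S" "x \<in> S" "y \<in> S"
  shows "\<exists>!n. n < card S \<and> (f ^^ n) x = y"
proof -
  have S: "S = orbit f x"
    using assms(1,3) by (rule orbit_cyclic_eq3[symmetric])
  then have "x \<in> orbit f x"
    using assms(3) by simp
  then have img: "S = (\<lambda>n. (f ^^ n) x) ` {0..<funpow_dist1 f x x}"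
    and inj: "inj_on (\<lambda>n. (f ^^ n) x) {0..<funpow_dist1 f x x}"
    unfolding S by (rule orbit_conv_funpow_dist1, rule inj_on_funpow_dist1)
  from inj have "card S = funpow_dist1 f x x"
    by (subst img) (simp only: card_image card_atLeastLessThan minus_nat.diff_0)
  with img inj assms(4) show ?thesis
    by (auto simp: inj_on_def)
qed

lemma perm_seq_cong:
  assumes "\<And>j. j \<in> {1..<i} \<Longrightarrow> p j = p' j" "\<And>j. j \<in> {1..<i} \<Longrightarrow> k j = k' j"
  shows "perm_seq R p k i = perm_seq R p' k' i"
  using assms by (induction R p k i rule: perm_seq.induct) auto

text \<open>Shows that the defining equations of the cipher have the triangular shape asked for by
  \<open>Ex1_PiE_triangular\<close>.\<close>

lemma perm_seq_restrict [simp]: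
  "perm_seq R (restrict p {1..<i}) k i = perm_seq R p k i"
  "perm_seq R p (restrict k {1..<i}) i = perm_seq R p k i"
  by (auto intro: perm_seq_cong)

text \<open>Only entries below \<open>i\<close> are bounded, so that this also covers a word that is
  known only up to position \<open>i - 1\<close>.\<close>

lemma perm_seq_in_K:
  assumes "\<And>j. 2 \<le> j \<Longrightarrow> j \<le> i \<Longrightarrow> R j ` (K (j - 1) \<times> {0..<j} \<times> {0..<j}) \<subseteq> K j"
    and "p \<in> (\<Pi> j\<in>{1..<i}. {0..j})" "k \<in> (\<Pi> j\<in>{1..<i}. {0..j})" "1 \<le> i"
  shows "perm_seq R p k i \<in> K i"
  using assms
proof (induction R p k i rule: perm_seq.induct)
  case (3 R p k i)
  have "perm_seq R p k (Suc i) \<in> K (Suc i)"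
    using 3 by (auto simp: Pi_iff)
  \<comment> \<open>The range of the entries at position \<open>Suc i\<close> is exactly the
    argument range of \<open>R (Suc (Suc i))\<close>.\<close>
  moreover have "k (Suc i) \<le> Suc i" "p (Suc i) \<le> Suc i"
    using "3.prems"(2,3) by (auto simp: Pi_iff)
  ultimately have "(perm_seq R p k (Suc i), k (Suc i), p (Suc i))
      \<in> K (Suc (Suc i) - 1) \<times> {0..<Suc (Suc i)} \<times> {0..<Suc (Suc i)}"
    by auto
  then show ?case
    using "3.prems"(1)[of "Suc (Suc i)"] by auto
qed (use K_1 in auto)

lemma K_funpow_permutes:
  assumes "\<pi> \<in> K i"
  shows "(\<pi> ^^ n) permutes {0..i}"
  using assms by (simp add: K_def permutes_funpow)

lemma K_ex1_funpow:
  assumes "\<pi> \<in> K i" "x \<in> {0..i}" "y \<in> {0..i}"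
  shows "\<exists>!n. n \<in> {0..i} \<and> (\<pi> ^^ n) x = y"
  using cyclic_on_ex1_funpow[of \<pi> "{0..i}" x y] assms by (simp add: K_def less_Suc_eq_le)

context
  fixes \<nu> :: nat
    and R :: "nat \<Rightarrow> (nat \<Rightarrow> nat) \<times> nat \<times> nat \<Rightarrow> (nat \<Rightarrow> nat)"
  assumes R: "\<And>i. 2 \<le> i \<Longrightarrow> i \<le> \<nu> - 1 \<Longrightarrow> R i ` (K (i - 1) \<times> {0..<i} \<times> {0..<i}) \<subseteq> K i"
begin

lemma perm_seq_in_K_words:
  assumes "p \<in> (\<Pi> j\<in>{1..<i}. {0..j})" "k \<in> (\<Pi> j\<in>{1..<i}. {0..j})" "i \<in> {1..<\<nu>}"
  shows "perm_seq R p k i \<in> K i"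
  using assms by (intro perm_seq_in_K R) auto

lemma words_prefix:
  "w \<in> words \<nu> \<Longrightarrow> i \<in> {1..<\<nu>} \<Longrightarrow> w \<in> (\<Pi> j\<in>{1..<i}. {0..j})"
  "w \<in> words \<nu> \<Longrightarrow> i \<in> {1..<\<nu>} \<Longrightarrow> w i \<in> {0..i}"
  by (auto simp: words_def PiE_iff)

text \<open>The entries of \<open>c\<close> are given explicitly; only their range needs an
  argument.\<close>

lemma ex1_ciphertext:
  assumes "p \<in> words \<nu>" "k \<in> words \<nu>"
  shows "\<exists>!c. c \<in> words \<nu> \<and> cipher_relation \<nu> R p c k"
proof -
  have "\<exists>!c. c \<in> PiE {1..<\<nu>} (\<lambda>i. {0..i}) \<and>
      (\<forall>i\<in>{1..<\<nu>}. c i = (perm_seq R p k i ^^ k i) (p i))"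
  proof (rule Ex1_PiE_triangular)
    fix i assume i: "i \<in> {1..<\<nu>}"
    have "perm_seq R p k i \<in> K i"
      using assms i by (intro perm_seq_in_K_words words_prefix)
    then have "(perm_seq R p k i ^^ k i) (p i) \<in> {0..i}"
      using permutes_in_image[OF K_funpow_permutes] words_prefix(2)[OF assms(1) i] by blast
    then show "\<exists>!v. v \<in> {0..i} \<and> v = (perm_seq R p k i ^^ k i) (p i)"
      by blast
  qed
  then show ?thesis
    by (simp add: words_def cipher_relation_def del: One_nat_def)
qed

text \<open>The earlier entries of \<open>p\<close> determine the permutation at \<open>i\<close>,
  and \<open>p i\<close> is the preimage of \<open>c i\<close> under its known power.\<close>

lemma ex1_plaintext:
  assumes "c \<in> words \<nu>" "k \<in> words \<nu>"
  shows "\<exists>!p. p \<in> words \<nu> \<and> cipher_relation \<nu> R p c k"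
proof -
  have "\<exists>!p. p \<in> PiE {1..<\<nu>} (\<lambda>i. {0..i}) \<and>
      (\<forall>i\<in>{1..<\<nu>}. c i = (perm_seq R (restrict p {1..<i}) k i ^^ k i) (p i))"
  proof (rule Ex1_PiE_triangular)
    fix i p assume i: "i \<in> {1..<\<nu>}" and p: "p \<in> PiE {1..<i} (\<lambda>i. {0..i})"
    have "perm_seq R p k i \<in> K i"
      using p words_prefix(1)[OF assms(2) i] i by (intro perm_seq_in_K_words) auto
    then have bij: "bij_betw (perm_seq R p k i ^^ k i) {0..i} {0..i}"
      by (intro permutes_imp_bij K_funpow_permutes)
    then show "\<exists>!v. v \<in> {0..i} \<and> c i = (perm_seq R p k i ^^ k i) v"
      using bij_betw_imp_surj_on[OF bij] inj_onD[OF bij_betw_imp_inj_on[OF bij]]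
        words_prefix(2)[OF assms(1) i]
      by (intro ex_ex1I) (blast, simp)
  qed
  then show ?thesis
    by (simp add: words_def cipher_relation_def del: One_nat_def)
qed

text \<open>The earlier entries of \<open>k\<close> determine a cycle of length
  \<open>i + 1\<close>, and \<open>k i\<close> is the one exponent that moves \<open>p i\<close> to
  \<open>c i\<close>.\<close>

lemma ex1_key:
  assumes "p \<in> words \<nu>" "c \<in> words \<nu>"
  shows "\<exists>!k. k \<in> words \<nu> \<and> cipher_relation \<nu> R p c k"
proof -
  have "\<exists>!k. k \<in> PiE {1..<\<nu>} (\<lambda>i. {0..i}) \<and>
      (\<forall>i\<in>{1..<\<nu>}. c i = (perm_seq R p (restrict k {1..<i}) i ^^ k i) (p i))"
  proof (rule Ex1_PiE_triangular)
    fix i k assume i: "i \<in> {1..<\<nu>}" and k: "k \<in> PiE {1..<i} (\<lambda>i. {0..i})"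
    have "perm_seq R p k i \<in> K i"
      using k words_prefix(1)[OF assms(1) i] i by (intro perm_seq_in_K_words) auto
    then show "\<exists>!v. v \<in> {0..i} \<and> c i = (perm_seq R p k i ^^ v) (p i)"
      using K_ex1_funpow words_prefix(2)[OF assms(1) i] words_prefix(2)[OF assms(2) i]
      by (simp add: eq_commute)
  qed
  then show ?thesis
    by (simp add: words_def cipher_relation_def del: One_nat_def)
qed

lemma trijection_cipher_relation:
  "trijection (words \<nu>) (words \<nu>) (words \<nu>) (cipher_relation \<nu> R)"
  unfolding trijection_def
  by (intro conjI ballI is_bijection_betweenI ex1_ciphertext ex1_plaintext ex1_key)

lemma not_positionwise_cipher_relation:
  assumes "3 \<le> \<nu>" "depends_on_each_argument (K 1) {0..<2} {0..<2} (R 2)"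
  shows "\<not> positionwise \<nu> (cipher_relation \<nu> R)"
proof
  assume "positionwise \<nu> (cipher_relation \<nu> R)"
  then obtain f where f:
    "\<And>p c k. p \<in> words \<nu> \<Longrightarrow> c \<in> words \<nu> \<Longrightarrow> k \<in> words \<nu> \<Longrightarrow>
      cipher_relation \<nu> R p c k \<Longrightarrow> c 2 = f (p 2) (k 2)"
    using assms(1) unfolding positionwise_def by force
  \<comment> \<open>The key argument of \<open>R 2\<close> has two values, so the dependence on it
    applies and yields keys \<open>b\<close>, \<open>b'\<close> for the same first plaintext entry
    \<open>d\<close>.\<close>
  have "\<exists>b\<in>{0..<2::nat}. \<exists>b'\<in>{0..<2}. b \<noteq> b'"
    by (rule bexI[of _ 0], rule bexI[of _ 1]) auto
  then obtain a b b' d where *: "a \<in> K 1" "b \<in> {0..<2}" "b' \<in> {0..<2}" "d \<in> {0..<2}"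
      and ne: "R 2 (a, b, d) \<noteq> R 2 (a, b', d)"
    using assms(2) unfolding depends_on_each_argument_def by blast
  from ne obtain x where x: "R 2 (a, b, d) x \<noteq> R 2 (a, b', d) x"
    by blast
  have a: "a = transpose 0 1"
    using *(1) unfolding K_1 by simp
  have "R 2 ` (K 1 \<times> {0..<2} \<times> {0..<2}) \<subseteq> K 2"
    using R[of 2] assms(1) by simp
  then have "R 2 (a, e, d) \<in> K 2" if "e \<in> {0..<2}" for e
    using *(1,4) that by blast
  then have "R 2 (a, e, d) permutes {0..2}" if "e \<in> {0..<2}" for e
    using that by (simp add: K_def)
  \<comment> \<open>Both permutations fix every point outside \<open>{0..2}\<close>, so
    \<open>x\<close> is a legitimate value for \<open>p 2\<close>.\<close>
  then have "x \<in> {0..2}"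
    using x *(2,3) by (metis permutes_not_in)
  \<comment> \<open>Entry 1 of each word is an argument of \<open>R 2\<close>; entry 2 supplies the
    point \<open>x\<close> and the exponent 1. Changing \<open>e\<close> leaves \<open>p 2\<close>
    and the second key entry alone but can change \<open>c 2\<close>.\<close>
  define p :: "nat \<Rightarrow> nat"
    where "p = (\<lambda>i\<in>{1..<\<nu>}. if i = 1 then d else if i = 2 then x else 0)"
  define k :: "nat \<Rightarrow> nat \<Rightarrow> nat"
    where "k e = (\<lambda>i\<in>{1..<\<nu>}. if i = 1 then e else if i = 2 then 1 else 0)" for e
  have p: "p \<in> words \<nu>"
    using \<open>x \<in> {0..2}\<close> *(4) by (auto simp: p_def words_def)
  have "R 2 (a, e, d) x = f x 1" if e: "e \<in> {0..<2}" for e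
  proof -
    have k: "k e \<in> words \<nu>"
      using e by (auto simp: k_def words_def)
    obtain c where c: "c \<in> words \<nu>" "cipher_relation \<nu> R p c (k e)"
      using ex1_ciphertext[OF p k] by blast
    have "c 2 = R 2 (a, e, d) x"
      using c(2) assms(1) by (simp add: cipher_relation_def p_def k_def a numeral_2_eq_2)
    moreover have "c 2 = f x 1"
      using f[OF p c(1) k c(2)] assms(1) by (simp add: p_def k_def)
    ultimately show ?thesis by simp
  qed
  with x *(2,3) show False by metis
qed

end

theorem proposition2:
  fixes \<nu> :: nat
    and R :: "nat \<Rightarrow> (nat \<Rightarrow> nat) \<times> nat \<times> nat \<Rightarrow> (nat \<Rightarrow> nat)"
  assumes "\<nu> \<ge> 2"
    and "\<And>i. 2 \<le> i \<Longrightarrow> i \<le> \<nu> - 1 \<Longrightarrow>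
           R i ` (K (i - 1) \<times> {0..<i} \<times> {0..<i}) = K i"
    and "\<And>i. 2 \<le> i \<Longrightarrow> i \<le> \<nu> - 1 \<Longrightarrow>
           depends_on_each_argument (K (i - 1)) {0..<i} {0..<i} (R i)"
  shows "trijection (words \<nu>) (words \<nu>) (words \<nu>) (cipher_relation \<nu> R) \<and>
         \<not> degenerate \<nu> (cipher_relation \<nu> R)"
proof
  show "trijection (words \<nu>) (words \<nu>) (words \<nu>) (cipher_relation \<nu> R)"
    using assms(2) by (intro trijection_cipher_relation) auto
  show "\<not> degenerate \<nu> (cipher_relation \<nu> R)"
    \<comment> \<open>For \<open>\<nu> = 2\<close> the relation is non-degenerate by definition;
      otherwise position 2 exists and \<open>R 2\<close> is available.\<close>
    unfolding degenerate_def
    using not_positionwise_cipher_relation[of \<nu> R] assms(2) assms(3)[of 2] by force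
qed

end
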